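(* Let $X$ be a $T_1$ topological space containing at least three elements. Then $\operatorname{diam}(\Gamma(C(X)_F)) = 3$ and $\operatorname{gr}(\Gamma(C(X)_F)) = 3$.
   Context: $C(X)_F$ denotes the ring (under pointwise operations) of all functions $f : X \to \mathbb{R}$ for which there is a finite subset $F \subseteq X$ such that the restriction $f|_{X\setminus F}$ is continuous on the subspace $X \setminus F$. $\Gamma(C(X)_F)$ is the zero divisor graph of this ring: its vertices are the nonzero zero divisors of $C(X)_F$, and two vertices $f, g$ are adjacent if $fg = 0$. For vertices $f,g$, $d(f,g)$ is the length of a shortest path between $f$ and $g$. The diameter $\operatorname{diam}(\Gamma(C(X)_F))$ is the maximum of all $d(f,g)$ over vertices $f,g$. The girth $\operatorname{gr}(\Gamma(C(X)_F))$ is the length of a smallest cycle in the graph ($\infty$ if there is no cycle). *)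

theory Defs
  imports
    "HOL-Analysis.T1_Spaces"
    "HOL-Algebra.Ring"
    "Graph_Theory.Arc_Walk"
    "HOL-Library.Extended_Nat"
begin

text \<open>The ring \<open>C(X)\<^sub>F\<close>. A function on the space \<open>X\<close> is represented by its unique extension that is
  \<^const>\<open>undefined\<close> outside \<^term>\<open>topspace X\<close>, so that equality in the carrier is equality on \<open>X\<close>.\<close>

definition CF :: "'a topology \<Rightarrow> ('a \<Rightarrow> real) ring" where
  "CF X = \<lparr>carrier = {f \<in> extensional (topspace X).
                \<exists>F. finite F \<and> F \<subseteq> topspace X \<and>
                    continuous_map (subtopology X (topspace X - F)) euclideanreal f},
          mult = (\<lambda>f g. \<lambda>x\<in>topspace X. f x * g x),
          one = (\<lambda>x\<in>topspace X. 1),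
          zero = (\<lambda>x\<in>topspace X. 0),
          add = (\<lambda>f g. \<lambda>x\<in>topspace X. f x + g x)\<rparr>"

definition zero_divisor :: "('r, 'm) ring_scheme \<Rightarrow> 'r \<Rightarrow> bool" where
  "zero_divisor R a \<longleftrightarrow>
     a \<in> carrier R \<and> (\<exists>b\<in>carrier R. b \<noteq> \<zero>\<^bsub>R\<^esub> \<and> a \<otimes>\<^bsub>R\<^esub> b = \<zero>\<^bsub>R\<^esub>)"

text \<open>Zero divisor graph of a commutative ring, as a symmetric digraph whose arcs are ordered pairs
  of vertices. Only distinct vertices are joined; in a reduced ring such as \<open>C(X)\<^sub>F\<close> this
  excludes nothing, since there \<open>f f = 0\<close> forces \<open>f = 0\<close>.\<close>

definition zero_divisor_graph :: "('r, 'm) ring_scheme \<Rightarrow> ('r, 'r \<times> 'r) pre_digraph" where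
  "zero_divisor_graph R =
     (let V = {a. zero_divisor R a \<and> a \<noteq> \<zero>\<^bsub>R\<^esub>} in
      \<lparr>verts = V,
       arcs = {(a, b). a \<in> V \<and> b \<in> V \<and> a \<noteq> b \<and> a \<otimes>\<^bsub>R\<^esub> b = \<zero>\<^bsub>R\<^esub>},
       tail = fst,
       head = snd\<rparr>)"

text \<open>Distance, diameter and girth take values in \<^typ>\<open>enat\<close>. The infimum over an empty set is
  \<open>\<infinity>\<close>, and the infimum of a nonempty set and a finite supremum of a nonempty set are attained.\<close>

definition graph_dist :: "('v, 'e) pre_digraph \<Rightarrow> 'v \<Rightarrow> 'v \<Rightarrow> enat" where
  "graph_dist G u v = (INF p\<in>{p. pre_digraph.apath G u p v}. enat (length p))"

definition graph_diam :: "('v, 'e) pre_digraph \<Rightarrow> enat" where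
  "graph_diam G = (SUP u\<in>verts G. SUP v\<in>verts G. graph_dist G u v)"

text \<open>\<^const>\<open>pre_digraph.cycle\<close> is the notion for digraphs and admits going back and forth along an
  edge. In a symmetric digraph without loops and parallel arcs, the cycles of the undirected graph
  are those of length at least 3.\<close>

definition graph_girth :: "('v, 'e) pre_digraph \<Rightarrow> enat" where
  "graph_girth G = (INF p\<in>{p. pre_digraph.cycle G p \<and> 3 \<le> length p}. enat (length p))"

lemma CF_carrierI:
  assumes "f \<in> extensional (topspace X)" "finite F" "F \<subseteq> topspace X"
    "continuous_map (subtopology X (topspace X - F)) euclideanreal f"
  shows "f \<in> carrier (CF X)"
  using assms by (auto simp: CF_def)

lemma CF_carrier_pointwise2:
  assumes f: "f \<in> carrier (CF X)" and g: "g \<in> carrier (CF X)"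
    and h: "\<And>T. continuous_map T euclideanreal f \<Longrightarrow> continuous_map T euclideanreal g \<Longrightarrow>
              continuous_map T euclideanreal (\<lambda>x. h (f x) (g x))"
  shows "(\<lambda>x\<in>topspace X. h (f x) (g x)) \<in> carrier (CF X)"
proof -
  obtain F where F: "finite F" "F \<subseteq> topspace X"
    "continuous_map (subtopology X (topspace X - F)) euclideanreal f"
    using f by (auto simp: CF_def)
  obtain G where G: "finite G" "G \<subseteq> topspace X"
    "continuous_map (subtopology X (topspace X - G)) euclideanreal g"
    using g by (auto simp: CF_def)
  let ?T = "subtopology X (topspace X - (F \<union> G))"
  have "continuous_map ?T euclideanreal f" "continuous_map ?T euclideanreal g"
    by (rule continuous_map_from_subtopology_mono[OF F(3)], blast)
      (rule continuous_map_from_subtopology_mono[OF G(3)], blast)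
  then have "continuous_map ?T euclideanreal (\<lambda>x. h (f x) (g x))"
    by (rule h)
  then have "continuous_map ?T euclideanreal (\<lambda>x\<in>topspace X. h (f x) (g x))"
    by (rule continuous_map_eq) auto
  with F(1,2) G(1,2) show ?thesis
    by (intro CF_carrierI[where F = "F \<union> G"]) auto
qed

lemma CF_carrier_const: "(\<lambda>x\<in>topspace X. c) \<in> carrier (CF X)"
proof (rule CF_carrierI[where F = "{}"])
  have "continuous_map (subtopology X (topspace X - {})) euclideanreal (\<lambda>x. c)"
    by simp
  then show "continuous_map (subtopology X (topspace X - {})) euclideanreal (\<lambda>x\<in>topspace X. c)"
    by (rule continuous_map_eq) auto
qed auto

lemma CF_simps:
  "\<zero>\<^bsub>CF X\<^esub> = (\<lambda>x\<in>topspace X. 0)"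
  "\<one>\<^bsub>CF X\<^esub> = (\<lambda>x\<in>topspace X. 1)"
  "f \<otimes>\<^bsub>CF X\<^esub> g = (\<lambda>x\<in>topspace X. f x * g x)"
  "f \<oplus>\<^bsub>CF X\<^esub> g = (\<lambda>x\<in>topspace X. f x + g x)"
  by (simp_all add: CF_def)

lemma CF_closed:
  assumes f: "f \<in> carrier (CF X)" and g: "g \<in> carrier (CF X)"
  shows "f \<oplus>\<^bsub>CF X\<^esub> g \<in> carrier (CF X)" "f \<otimes>\<^bsub>CF X\<^esub> g \<in> carrier (CF X)"
    "(\<lambda>x\<in>topspace X. - f x) \<in> carrier (CF X)"
    "\<zero>\<^bsub>CF X\<^esub> \<in> carrier (CF X)" "\<one>\<^bsub>CF X\<^esub> \<in> carrier (CF X)"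
proof -
  show "f \<oplus>\<^bsub>CF X\<^esub> g \<in> carrier (CF X)"
    unfolding CF_simps
    by (rule CF_carrier_pointwise2[OF f g, where h = "(+)"]) (rule continuous_map_add)
  show "f \<otimes>\<^bsub>CF X\<^esub> g \<in> carrier (CF X)"
    unfolding CF_simps
    by (rule CF_carrier_pointwise2[OF f g, where h = "(*)"]) (rule continuous_map_real_mult)
  show "(\<lambda>x\<in>topspace X. - f x) \<in> carrier (CF X)"
    by (rule CF_carrier_pointwise2[OF f f, where h = "\<lambda>a b. - a"]) (rule continuous_map_minus)
qed (simp_all only: CF_simps CF_carrier_const)

lemma CF_eqI:
  assumes "f \<in> carrier (CF X)" "g \<in> carrier (CF X)" "\<And>x. x \<in> topspace X \<Longrightarrow> f x = g x"
  shows "f = g"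
proof (rule extensionalityI)
  show "f \<in> extensional (topspace X)" "g \<in> extensional (topspace X)"
    using assms(1,2) by (simp_all add: CF_def)
qed (rule assms(3))

lemma cring_CF: "cring (CF X)"
proof (rule cringI)
  show "abelian_group (CF X)"
  proof (rule abelian_groupI)
    fix f assume f: "f \<in> carrier (CF X)"
    have "(\<lambda>x\<in>topspace X. - f x) \<oplus>\<^bsub>CF X\<^esub> f = \<zero>\<^bsub>CF X\<^esub>"
      by (rule CF_eqI[where X = X]) (simp_all add: CF_closed[OF f f] CF_closed(1) f, simp add: CF_simps)
    then show "\<exists>g\<in>carrier (CF X). g \<oplus>\<^bsub>CF X\<^esub> f = \<zero>\<^bsub>CF X\<^esub>"
      using CF_closed(3)[OF f f] by blast
    show "\<zero>\<^bsub>CF X\<^esub> \<oplus>\<^bsub>CF X\<^esub> f = f"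
      by (rule CF_eqI[where X = X]) (simp_all add: CF_closed[OF f f] CF_closed(1) f, simp add: CF_simps)
  next
    fix f g h assume fgh: "f \<in> carrier (CF X)" "g \<in> carrier (CF X)" "h \<in> carrier (CF X)"
    show "f \<oplus>\<^bsub>CF X\<^esub> g \<oplus>\<^bsub>CF X\<^esub> h = f \<oplus>\<^bsub>CF X\<^esub> (g \<oplus>\<^bsub>CF X\<^esub> h)"
      by (rule CF_eqI[where X = X]) (simp_all add: CF_closed(1) fgh, simp add: CF_simps)
  next
    fix f g assume fg: "f \<in> carrier (CF X)" "g \<in> carrier (CF X)"
    show "f \<oplus>\<^bsub>CF X\<^esub> g = g \<oplus>\<^bsub>CF X\<^esub> f"
      by (simp add: CF_simps add.commute)
  qed (simp_all add: CF_closed(1), simp add: CF_simps CF_carrier_const)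
  show "comm_monoid (CF X)"
  proof (rule comm_monoidI)
    fix f assume f: "f \<in> carrier (CF X)"
    show "\<one>\<^bsub>CF X\<^esub> \<otimes>\<^bsub>CF X\<^esub> f = f"
      by (rule CF_eqI[where X = X]) (simp_all add: CF_closed[OF f f] CF_closed(2) f, simp add: CF_simps)
  next
    fix f g h assume fgh: "f \<in> carrier (CF X)" "g \<in> carrier (CF X)" "h \<in> carrier (CF X)"
    show "f \<otimes>\<^bsub>CF X\<^esub> g \<otimes>\<^bsub>CF X\<^esub> h = f \<otimes>\<^bsub>CF X\<^esub> (g \<otimes>\<^bsub>CF X\<^esub> h)"
      by (rule CF_eqI[where X = X]) (simp_all add: CF_closed(2) fgh, simp add: CF_simps)
  next
    fix f g assume fg: "f \<in> carrier (CF X)" "g \<in> carrier (CF X)"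
    show "f \<otimes>\<^bsub>CF X\<^esub> g = g \<otimes>\<^bsub>CF X\<^esub> f"
      by (simp add: CF_simps mult.commute)
  qed (simp_all add: CF_closed(2), simp add: CF_simps CF_carrier_const)
  fix f g h assume fgh: "f \<in> carrier (CF X)" "g \<in> carrier (CF X)" "h \<in> carrier (CF X)"
  show "(f \<oplus>\<^bsub>CF X\<^esub> g) \<otimes>\<^bsub>CF X\<^esub> h = f \<otimes>\<^bsub>CF X\<^esub> h \<oplus>\<^bsub>CF X\<^esub> g \<otimes>\<^bsub>CF X\<^esub> h"
    by (rule CF_eqI[where X = X]) (simp_all add: CF_closed(1,2) fgh, simp add: CF_simps distrib_right)
qed

lemma (in cring) zero_divisor_graph_simple:
  "loopfree_digraph (zero_divisor_graph R)"
  "nomulti_digraph (zero_divisor_graph R)"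
  "sym_digraph (zero_divisor_graph R)"
proof -
  show "loopfree_digraph (zero_divisor_graph R)" "nomulti_digraph (zero_divisor_graph R)"
    by (unfold_locales; auto simp: zero_divisor_graph_def Let_def arc_to_ends_def)+
  then interpret loopfree_digraph "zero_divisor_graph R"
    by simp
  have arcs: "arcs_ends (zero_divisor_graph R) = arcs (zero_divisor_graph R)"
    by (simp add: arcs_ends_conv zero_divisor_graph_def Let_def)
  have "b \<otimes> a = \<zero>" if "a \<in> carrier R" "b \<in> carrier R" "a \<otimes> b = \<zero>" for a b
    using that m_comm[of b a] by simp
  then have "symmetric (zero_divisor_graph R)"
    unfolding symmetric_def arcs
    by (intro symI) (auto simp: zero_divisor_graph_def Let_def zero_divisor_def)
  then show "sym_digraph (zero_divisor_graph R)"
    by unfold_locales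
qed

end

theory Submission
  imports Defs
begin

text \<open>A vertex of the zero divisor graph of \<open>C(X)\<^sub>F\<close> is a function that has both a zero and a nonzero
  value. Indeed every function that is constant off a single point belongs to \<open>C(X)\<^sub>F\<close>, whatever
  the topology of \<open>X\<close>; so a function with a zero \<open>p\<close> is annihilated by the indicator \<open>\<delta>\<^sub>p\<close> of \<open>p\<close>,
  and a nonzero annihilator conversely forces a zero. Two vertices are adjacent iff at each point at
  least one of them vanishes.

  If \<open>f\<close> and \<open>g\<close> have zeros at \<open>p\<close> and \<open>q\<close>, then \<open>f\<close>, \<open>\<delta>\<^sub>p\<close>, \<open>\<delta>\<^sub>q\<close>, \<open>g\<close> is a walk (drop one of the
  indicators if \<open>p = q\<close>), so distances are at most 3. The bound is attained: for distinct points
  \<open>a\<close>, \<open>b\<close>, the functions \<open>1 - \<delta>\<^sub>a\<close> and \<open>1 - \<delta>\<^sub>b\<close> are both nonzero at a third point, and a common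
  neighbour would have to vanish both off \<open>a\<close> and off \<open>b\<close>, that is, everywhere. Finally, the
  indicators of three distinct points form a triangle.\<close>

lemma (in wf_digraph) graph_dist_le_awalk:
  assumes "awalk u p v"
  shows "graph_dist G u v \<le> enat (length p)"
  using assms
proof (induct rule: awalk_to_apath_induct)
  case (path p)
  then have "apath u p v"
    by (simp add: apath_def)
  then show ?case
    unfolding graph_dist_def by (intro INF_lower) simp
next
  case (decomp p q r s)
  then have "length (q @ s) \<le> length p"
    by (auto elim!: awalk_cyc_decompE)
  then have "enat (length (q @ s)) \<le> enat (length p)"
    by simp
  with decomp(4) show ?case
    by (rule order_trans)
qed

text \<open>The assumptions rule out paths of length 0, 1 and 2.\<close>

lemma (in wf_digraph) graph_dist_ge_3:
  assumes "u \<noteq> v" "\<not> u \<rightarrow> v" "\<And>w. u \<rightarrow> w \<Longrightarrow> \<not> w \<rightarrow> v"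
  shows "3 \<le> graph_dist G u v"
  unfolding graph_dist_def
proof (intro INF_greatest)
  fix p assume "p \<in> {p. apath u p v}"
  then have p: "set p \<subseteq> arcs G" "cas u p v"
    by (simp_all add: apath_def awalk_def)
  have "3 \<le> length p"
  proof (rule ccontr)
    assume "\<not> 3 \<le> length p"
    then consider "p = []" | e where "p = [e]" | e e' where "p = [e, e']"
      by (cases p rule: remdups_adj.cases) (auto simp: Suc_le_eq not_less_eq)
    then show False
    proof cases
      case 1
      with p assms(1) show ?thesis by simp
    next
      case 2
      with p assms(2) show ?thesis
        by (auto intro: in_arcs_imp_in_arcs_ends)
    next
      case 3
      with p have "u \<rightarrow> head G e" "head G e \<rightarrow> v"
        using in_arcs_imp_in_arcs_ends[of e] in_arcs_imp_in_arcs_ends[of e'] by auto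
      with assms(3) show ?thesis by blast
    qed
  qed
  then show "3 \<le> enat (length p)"
    by (simp add: numeral_eq_enat)
qed

text \<open>The function on \<open>X\<close> with value \<open>s\<close> at the point \<open>p\<close> and value \<open>t\<close> elsewhere. Thus
  \<open>point_fun X p 1 0\<close> is the indicator of \<open>p\<close>, and \<open>point_fun X p 0 1\<close> is its complement.\<close>

definition point_fun :: "'a topology \<Rightarrow> 'a \<Rightarrow> real \<Rightarrow> real \<Rightarrow> 'a \<Rightarrow> real" where
  "point_fun X p s t = (\<lambda>x\<in>topspace X. if x = p then s else t)"

lemma point_fun_apply [simp]:
  "x \<in> topspace X \<Longrightarrow> point_fun X p s t x = (if x = p then s else t)"
  by (simp add: point_fun_def)

lemma point_fun_in_CF:
  assumes "p \<in> topspace X"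
  shows "point_fun X p s t \<in> carrier (CF X)"
proof (rule CF_carrierI[where F = "{p}"])
  have "continuous_map (subtopology X (topspace X - {p})) euclideanreal (\<lambda>x. t)"
    by simp
  then show "continuous_map (subtopology X (topspace X - {p})) euclideanreal (point_fun X p s t)"
    by (rule continuous_map_eq) auto
qed (use assms in \<open>auto simp: point_fun_def\<close>)

lemma CF_eq_zero_iff:
  assumes "f \<in> carrier (CF X)"
  shows "f = \<zero>\<^bsub>CF X\<^esub> \<longleftrightarrow> (\<forall>x\<in>topspace X. f x = 0)"
  using CF_eqI[OF assms CF_closed(4)[OF assms assms]] by (auto simp: CF_simps)

lemma CF_mult_eq_zero_iff:
  assumes "f \<in> carrier (CF X)" "g \<in> carrier (CF X)"
  shows "f \<otimes>\<^bsub>CF X\<^esub> g = \<zero>\<^bsub>CF X\<^esub> \<longleftrightarrow> (\<forall>x\<in>topspace X. f x = 0 \<or> g x = 0)"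
  unfolding CF_eq_zero_iff[OF CF_closed(2)[OF assms]] by (simp add: CF_simps)

lemma zero_divisor_CF_iff:
  "zero_divisor (CF X) f \<longleftrightarrow> f \<in> carrier (CF X) \<and> (\<exists>x\<in>topspace X. f x = 0)"
proof (intro iffI conjI)
  assume "zero_divisor (CF X) f"
  then obtain g where fg: "f \<in> carrier (CF X)" "g \<in> carrier (CF X)"
    and "g \<noteq> \<zero>\<^bsub>CF X\<^esub>" "f \<otimes>\<^bsub>CF X\<^esub> g = \<zero>\<^bsub>CF X\<^esub>"
    by (auto simp: zero_divisor_def)
  then show "f \<in> carrier (CF X)" "\<exists>x\<in>topspace X. f x = 0"
    using CF_eq_zero_iff[OF fg(2)] CF_mult_eq_zero_iff[OF fg] by auto
next
  assume *: "f \<in> carrier (CF X) \<and> (\<exists>x\<in>topspace X. f x = 0)"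
  then obtain p where f: "f \<in> carrier (CF X)" and p: "p \<in> topspace X" "f p = 0"
    by blast
  let ?g = "point_fun X p 1 0"
  have g: "?g \<in> carrier (CF X)"
    by (rule point_fun_in_CF[OF p(1)])
  have "?g \<noteq> \<zero>\<^bsub>CF X\<^esub>" "f \<otimes>\<^bsub>CF X\<^esub> ?g = \<zero>\<^bsub>CF X\<^esub>"
    using p CF_eq_zero_iff[OF g] CF_mult_eq_zero_iff[OF f g] by auto
  with f g show "zero_divisor (CF X) f"
    by (auto simp: zero_divisor_def)
qed

lemma verts_CF_iff:
  "f \<in> verts (zero_divisor_graph (CF X)) \<longleftrightarrow>
     f \<in> carrier (CF X) \<and> (\<exists>x\<in>topspace X. f x = 0) \<and> (\<exists>x\<in>topspace X. f x \<noteq> 0)"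
  using CF_eq_zero_iff[of f X] by (auto simp: zero_divisor_graph_def Let_def zero_divisor_CF_iff)

text \<open>Distinctness of the ends need not be required: if \<open>f f = 0\<close> then \<open>f\<close> vanishes everywhere and
  is not a vertex.\<close>

lemma arcs_CF_iff:
  "(f, g) \<in> arcs (zero_divisor_graph (CF X)) \<longleftrightarrow>
     f \<in> verts (zero_divisor_graph (CF X)) \<and> g \<in> verts (zero_divisor_graph (CF X)) \<and>
     (\<forall>x\<in>topspace X. f x = 0 \<or> g x = 0)"
  (is "?L \<longleftrightarrow> ?R")
proof -
  have "?L \<longleftrightarrow> f \<in> verts (zero_divisor_graph (CF X)) \<and> g \<in> verts (zero_divisor_graph (CF X)) \<and>
      f \<noteq> g \<and> f \<otimes>\<^bsub>CF X\<^esub> g = \<zero>\<^bsub>CF X\<^esub>"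
    by (simp add: zero_divisor_graph_def Let_def)
  also have "\<dots> \<longleftrightarrow> ?R"
    using CF_mult_eq_zero_iff[of f X g] by (auto simp: verts_CF_iff)
  finally show ?thesis .
qed

lemma zero_divisor_graph_ends [simp]:
  "tail (zero_divisor_graph R) = fst" "head (zero_divisor_graph R) = snd"
  by (simp_all add: zero_divisor_graph_def Let_def)

lemma arcs_ends_zero_divisor_graph:
  "arcs_ends (zero_divisor_graph R) = arcs (zero_divisor_graph R)"
  by (simp add: arcs_ends_conv)

lemma wf_zero_divisor_graph_CF: "wf_digraph (zero_divisor_graph (CF X))"
  by (rule loopfree_digraph.axioms(1)[OF cring.zero_divisor_graph_simple(1)[OF cring_CF]])

lemma point_fun_vertex:
  assumes "p \<in> topspace X" "q \<in> topspace X" "p \<noteq> q"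
  shows "point_fun X p 1 0 \<in> verts (zero_divisor_graph (CF X))"
    and "point_fun X p 0 1 \<in> verts (zero_divisor_graph (CF X))"
  unfolding verts_CF_iff using assms point_fun_in_CF[OF assms(1)] by (auto intro: bexI[of _ q])

lemma graph_dist_CF_le_3:
  assumes f: "f \<in> verts (zero_divisor_graph (CF X))"
    and g: "g \<in> verts (zero_divisor_graph (CF X))"
  shows "graph_dist (zero_divisor_graph (CF X)) f g \<le> 3"
proof -
  interpret wf_digraph "zero_divisor_graph (CF X)"
    by (rule wf_zero_divisor_graph_CF)
  obtain p where p: "p \<in> topspace X" "f p = 0"
    using f by (auto simp: verts_CF_iff)
  obtain q where q: "q \<in> topspace X" "g q = 0"
    using g by (auto simp: verts_CF_iff)
  let ?P = "point_fun X p 1 0" and ?Q = "point_fun X q 1 0"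
  have PQ: "?P \<in> verts (zero_divisor_graph (CF X))" "?Q \<in> verts (zero_divisor_graph (CF X))"
    using f g p q point_fun_vertex(1)[of p X] point_fun_vertex(1)[of q X]
    by (metis verts_CF_iff)+
  have fP: "(f, ?P) \<in> arcs (zero_divisor_graph (CF X))"
    and Qg: "(?Q, g) \<in> arcs (zero_divisor_graph (CF X))"
    using f g p q PQ by (auto simp: arcs_CF_iff)
  \<comment> \<open>Only a walk: \<open>f = g\<close>, \<open>f = \<delta>\<^sub>q\<close> and \<open>g = \<delta>\<^sub>p\<close> are possible, so vertices may repeat.\<close>
  obtain w where w: "awalk f w g" "length w \<le> 3"
  proof (cases "p = q")
    case True
    then have "awalk f [(f, ?P), (?P, g)] g"
      using fP Qg f by (simp add: awalk_def)
    then show ?thesis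
      by (rule that) simp
  next
    case False
    then have "(?P, ?Q) \<in> arcs (zero_divisor_graph (CF X))"
      using PQ by (auto simp: arcs_CF_iff)
    then have "awalk f [(f, ?P), (?P, ?Q), (?Q, g)] g"
      using fP Qg f by (simp add: awalk_def)
    then show ?thesis
      by (rule that) simp
  qed
  have "graph_dist (zero_divisor_graph (CF X)) f g \<le> enat (length w)"
    by (rule graph_dist_le_awalk[OF w(1)])
  also have "\<dots> \<le> 3"
    using w(2) by (simp add: numeral_eq_enat)
  finally show ?thesis .
qed

lemma graph_dist_point_fun_ge_3:
  assumes abc: "a \<in> topspace X" "b \<in> topspace X" "c \<in> topspace X" "a \<noteq> b" "c \<noteq> a" "c \<noteq> b"
  shows "3 \<le> graph_dist (zero_divisor_graph (CF X)) (point_fun X a 0 1) (point_fun X b 0 1)"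
proof (rule wf_digraph.graph_dist_ge_3[OF wf_zero_divisor_graph_CF],
    unfold arcs_ends_zero_divisor_graph)
  have "point_fun X a 0 1 a \<noteq> point_fun X b 0 1 a"
    using abc by simp
  then show "point_fun X a 0 1 \<noteq> point_fun X b 0 1"
    by metis
  show "(point_fun X a 0 1, point_fun X b 0 1) \<notin> arcs (zero_divisor_graph (CF X))"
    using abc by (auto simp: arcs_CF_iff)
next
  fix h
  assume *: "(point_fun X a 0 1, h) \<in> arcs (zero_divisor_graph (CF X))"
  then have h: "h \<in> verts (zero_divisor_graph (CF X))"
    by (simp add: arcs_CF_iff)
  have a: "h x = 0" if "x \<in> topspace X" "x \<noteq> a" for x
    using * that by (fastforce simp: arcs_CF_iff)
  show "(h, point_fun X b 0 1) \<notin> arcs (zero_divisor_graph (CF X))"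
  proof
    assume "(h, point_fun X b 0 1) \<in> arcs (zero_divisor_graph (CF X))"
    then have "h x = 0" if "x \<in> topspace X" "x \<noteq> b" for x
      using that by (fastforce simp: arcs_CF_iff)
    with a h abc(4) show False
      by (auto simp: verts_CF_iff)
  qed
qed

lemma graph_girth_CF:
  assumes abc: "a \<in> topspace X" "b \<in> topspace X" "c \<in> topspace X" "a \<noteq> b" "c \<noteq> a" "c \<noteq> b"
  shows "graph_girth (zero_divisor_graph (CF X)) = 3"
proof (rule antisym)
  let ?G = "zero_divisor_graph (CF X)"
  let ?A = "point_fun X a 1 0" and ?B = "point_fun X b 1 0" and ?C = "point_fun X c 1 0"
  let ?p = "[(?A, ?B), (?B, ?C), (?C, ?A)]"
  have V: "?A \<in> verts ?G" "?B \<in> verts ?G" "?C \<in> verts ?G"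
    using abc point_fun_vertex(1)[of a X b] point_fun_vertex(1)[of b X a] point_fun_vertex(1)[of c X a]
    by auto
  then have "set ?p \<subseteq> arcs ?G"
    using abc by (auto simp: arcs_CF_iff)
  then have w: "pre_digraph.awalk ?G ?A ?p ?A"
    using V by (simp add: pre_digraph.awalk_def pre_digraph.cas.simps)
  have "?A a \<noteq> ?B a" "?A a \<noteq> ?C a" "?B b \<noteq> ?C b"
    using abc by simp_all
  then have "?A \<noteq> ?B" "?A \<noteq> ?C" "?B \<noteq> ?C"
    by metis+
  then have "distinct (tl (pre_digraph.awalk_verts ?G ?A ?p))"
    by (auto simp: pre_digraph.awalk_verts.simps)
  with w have "pre_digraph.cycle ?G ?p"
    unfolding pre_digraph.cycle_def by blast
  then have "graph_girth ?G \<le> enat (length ?p)"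
    unfolding graph_girth_def by (intro INF_lower) simp
  then show "graph_girth ?G \<le> 3"
    by (simp add: numeral_eq_enat eval_nat_numeral)
  show "3 \<le> graph_girth ?G"
    unfolding graph_girth_def by (intro INF_greatest) (simp add: numeral_eq_enat)
qed

theorem theorem3p7:
  fixes X :: "'a topology"
  assumes "t1_space X"
    and "\<exists>S\<subseteq>topspace X. card S = 3"
  shows "graph_diam (zero_divisor_graph (CF X)) = 3 \<and>
         graph_girth (zero_divisor_graph (CF X)) = 3"
proof -
  let ?G = "zero_divisor_graph (CF X)"
  obtain a b c where abc: "a \<in> topspace X" "b \<in> topspace X" "c \<in> topspace X"
      "a \<noteq> b" "c \<noteq> a" "c \<noteq> b"
    using assms(2) by (auto simp: card_3_iff)
  let ?f = "point_fun X a 0 1" and ?g = "point_fun X b 0 1"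
  have "?f \<in> verts ?G" "?g \<in> verts ?G"
    using abc point_fun_vertex(2)[of a X b] point_fun_vertex(2)[of b X a] by auto
  then have "graph_dist ?G ?f ?g \<le> graph_diam ?G"
    unfolding graph_diam_def by (blast intro: SUP_upper2)
  then have "3 \<le> graph_diam ?G"
    by (rule order_trans[OF graph_dist_point_fun_ge_3[OF abc]])
  moreover have "graph_diam ?G \<le> 3"
    unfolding graph_diam_def by (intro SUP_least graph_dist_CF_le_3)
  ultimately show ?thesis
    using graph_girth_CF[OF abc] by simp
qed

end
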